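(* Let $C=V(f)\subset\mathbb{P}^2$ be a reduced nearly free curve of degree $d$. Assume that there is a pair $(b,c)$ of nonzero elements of $\mathbb{C}$ such that $(0,bx_1,cx_2)\in\mathrm{Syz}(J_f)_1$. Write $\partial_0f=g\,x_1+\omega$ with $g\in R_{d-2}$ and $0\ne\omega\in\mathbb{C}[x_0]_{d-1}$. Then first and second syzygy matrices $M_f$ and $P_f$ in the minimal free resolution of $J_f$ are given by $$M_f=\begin{pmatrix}0&-\partial_1f&-\partial_2f\\ bx_1&\omega&0\\ cx_2&-\frac cb g x_2&\partial_0f\end{pmatrix}\qquad\text{and}\qquad P_f=\begin{pmatrix}\omega\\-bx_1\\-cx_2\end{pmatrix}.$$
   Context: Let $R=\mathbb{C}[x_0,x_1,x_2]$, $\mathbb{P}^2=\mathrm{Proj}(R)$, $\partial_i=\partial/\partial x_i$. For $f\in R_d$ defining a reduced singular curve $C=V(f)$, $J_f=\langle\partial_0f,\partial_1f,\partial_2f\rangle$ is the Jacobian ideal, and $\mathrm{Syz}(J_f)_t$ is the space of triples $(a,b,c)$ of forms of degree $t$ with $a\,\partial_0f+b\,\partial_1f+c\,\partial_2f=0$; $r=\mathrm{mdr}(f)$ is the least degree of a nonzero element of $\mathrm{Syz}(J_f)$. $C$ is nearly free if $N(f)=I_f/J_f$, with $I_f$ the saturation of $J_f$, is nonzero and $\dim_{\mathbb C} N(f)_s\le1$ for all $s\in\mathbb{Z}$. In that case the minimal free resolution of $J_f(d-1)$ has the form $$0\to R(-d+r-1)\xrightarrow{P_f}R(-r)\oplus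 R(-d+r)^2\xrightarrow{M_f}R^3\to J_f(d-1)\to0,$$ where $R^3\to J_f(d-1)$ is given by $(\partial_0f,\partial_1f,\partial_2f)$; $M_f$ and $P_f$ are called first and second syzygy matrices. Here $r=1$. Under the hypotheses of the claim, $\partial_0f\notin(x_1,x_2)$, and the expression $\partial_0f=g\,x_1+\omega$ with $g\in R_{d-2}$ and $\omega\in\mathbb{C}[x_0]_{d-1}$ nonzero exists. *)

theory Defs
  imports "HOL-Analysis.Analysis" "HOL-Computational_Algebra.Computational_Algebra"
begin

text \<open>
  The ring \<open>R = \<complex>[x0,x1,x2]\<close> is the iterated polynomial ring \<open>\<complex>[x2][x1][x0]\<close>; the variable
  \<open>x0\<close> is that of the outermost layer.
\<close>

type_synonym poly3 = "complex poly poly poly"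

definition cst :: "complex \<Rightarrow> poly3" where "cst a = [:[:[:a:]:]:]"

definition X0 :: poly3 where "X0 = [:0, 1:]"
definition X1 :: poly3 where "X1 = [:[:0, 1:]:]"
definition X2 :: poly3 where "X2 = [:[:[:0, 1:]:]:]"

text \<open>The coefficient of \<open>x0^i x1^j x2^k\<close>.\<close>

definition mcoeff :: "poly3 \<Rightarrow> nat \<Rightarrow> nat \<Rightarrow> nat \<Rightarrow> complex" where
  "mcoeff p i j k = coeff (coeff (coeff p i) j) k"

definition eval3 :: "poly3 \<Rightarrow> complex \<Rightarrow> complex \<Rightarrow> complex \<Rightarrow> complex" where
  "eval3 p a0 a1 a2 = poly (poly (poly p [:[:a0:]:]) [:a1:]) a2"

definition D0 :: "poly3 \<Rightarrow> poly3" where "D0 p = pderiv p"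
definition D1 :: "poly3 \<Rightarrow> poly3" where "D1 p = map_poly pderiv p"
definition D2 :: "poly3 \<Rightarrow> poly3" where "D2 p = map_poly (map_poly pderiv) p"

lemma coeff_of_nat_mult: "coeff (of_nat n * q) k = of_nat n * coeff q k"
  for q :: "'a::comm_ring_1 poly"
  by (simp add: of_nat_poly)

lemma mcoeff_D0: "mcoeff (D0 p) i j k = of_nat (Suc i) * mcoeff p (Suc i) j k"
  by (simp only: mcoeff_def D0_def coeff_pderiv coeff_of_nat_mult)

lemma mcoeff_D1: "mcoeff (D1 p) i j k = of_nat (Suc j) * mcoeff p i (Suc j) k"
  by (simp only: mcoeff_def D1_def coeff_map_poly pderiv_0 coeff_pderiv coeff_of_nat_mult)

lemma mcoeff_D2: "mcoeff (D2 p) i j k = of_nat (Suc k) * mcoeff p i j (Suc k)"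
  by (simp add: mcoeff_def D2_def coeff_map_poly coeff_pderiv)

text \<open>The graded piece \<open>R_s\<close>. Degrees are integers, and \<open>R_s = 0\<close> for \<open>s < 0\<close>.\<close>

definition forms :: "int \<Rightarrow> poly3 set" where
  "forms s = {p. \<forall>i j k. mcoeff p i j k \<noteq> 0 \<longrightarrow> int (i + j + k) = s}"

text \<open>The subring \<open>\<complex>[x0]\<close> of \<open>R\<close>.\<close>

definition polys_x0 :: "poly3 set" where
  "polys_x0 = {p. \<forall>i j k. mcoeff p i j k \<noteq> 0 \<longrightarrow> j = 0 \<and> k = 0}"

text \<open>Ideals are spans for the \<open>R\<close>-module structure of \<open>R\<close> given by multiplication.\<close>

definition ideal_gen :: "poly3 set \<Rightarrow> poly3 set" where
  "ideal_gen S = module.span (*) S"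

definition irrelevant_ideal :: "poly3 set" where
  "irrelevant_ideal = ideal_gen {X0, X1, X2}"

definition jacobian_ideal :: "poly3 \<Rightarrow> poly3 set" where
  "jacobian_ideal f = ideal_gen {D0 f, D1 f, D2 f}"

text \<open>
  The saturation of \<open>J\<close> with respect to \<open>m = (x0,x1,x2)\<close>, that is, the union of the ideals
  \<open>J : m^n\<close>; the ideal \<open>m^n\<close> is generated by the monomials of degree \<open>n\<close>.
\<close>

definition saturation :: "poly3 set \<Rightarrow> poly3 set" where
  "saturation J =
     {p. \<exists>n. \<forall>i j k. i + j + k = n \<longrightarrow> X0 ^ i * X1 ^ j * X2 ^ k * p \<in> J}"

text \<open>
  For complex vector spaces \<open>U \<subseteq> W\<close> inside \<open>R\<close>: the classes of the elements of the finite set \<open>B\<close>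
  are pairwise distinct and form a basis of \<open>W/U\<close>.
\<close>

definition quotient_basis :: "poly3 set \<Rightarrow> poly3 set \<Rightarrow> poly3 set \<Rightarrow> bool" where
  "quotient_basis W U B \<longleftrightarrow> finite B \<and> B \<subseteq> W \<and>
     (\<forall>w\<in>W. \<exists>a. w - (\<Sum>v\<in>B. cst (a v) * v) \<in> U) \<and>
     (\<forall>a. (\<Sum>v\<in>B. cst (a v) * v) \<in> U \<longrightarrow> (\<forall>v\<in>B. a v = 0))"

text \<open>
  The dimension of \<open>W/U\<close>, for finite-dimensional \<open>W/U\<close> only. It is applied to graded pieces,
  which are finite-dimensional.
\<close>

definition quotient_dim :: "poly3 set \<Rightarrow> poly3 set \<Rightarrow> nat" where
  "quotient_dim W U = card (SOME B. quotient_basis W U B)"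

text \<open>\<open>N(f) = I_f/J_f\<close> is nonzero and its graded pieces have dimension at most one.\<close>

definition nearly_free :: "poly3 \<Rightarrow> bool" where
  "nearly_free f \<longleftrightarrow>
     (let J = jacobian_ideal f; I = saturation J in
        I \<noteq> J \<and> (\<forall>s. quotient_dim (I \<inter> forms s) (J \<inter> forms s) \<le> 1))"

text \<open>The curve \<open>V(f)\<close> in the projective plane has a singular point.\<close>

definition singular_curve :: "poly3 \<Rightarrow> bool" where
  "singular_curve f \<longleftrightarrow> (\<exists>a0 a1 a2. (a0, a1, a2) \<noteq> (0, 0, 0) \<and> eval3 f a0 a1 a2 = 0 \<and>
     eval3 (D0 f) a0 a1 a2 = 0 \<and> eval3 (D1 f) a0 a1 a2 = 0 \<and> eval3 (D2 f) a0 a1 a2 = 0)"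

text \<open>
  Components of vectors and matrices are indexed by the type \<open>3\<close>, in the order \<open>1, 2, 3\<close> of
  \<^const>\<open>vector\<close>; so component \<open>i\<close> of the gradient is the derivative with respect to \<open>x_(i-1)\<close>.
\<close>

definition grad :: "poly3 \<Rightarrow> poly3 ^ 3" where
  "grad f = vector [D0 f, D1 f, D2 f]"

text \<open>The homomorphism \<open>R^n \<rightarrow> R\<close> given by a row of elements of \<open>R\<close>.\<close>

definition row_map :: "poly3 ^ 'n \<Rightarrow> poly3 ^ 'n \<Rightarrow> poly3" where
  "row_map h v = (\<Sum>i\<in>UNIV. v $ i * h $ i)"

definition Syz :: "poly3 \<Rightarrow> int \<Rightarrow> (poly3 ^ 3) set" where
  "Syz f t = {v. (\<forall>i. v $ i \<in> forms t) \<and> row_map (grad f) v = 0}"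

definition mdr :: "poly3 \<Rightarrow> nat" where
  "mdr f = (LEAST t. \<exists>v\<in>Syz f (int t). v \<noteq> 0)"

text \<open>
  The matrix \<open>A\<close> defines a homomorphism of graded modules, homogeneous of degree \<open>0\<close>, from the
  direct sum of the \<open>R(-u j)\<close> to the direct sum of the \<open>R(-v i)\<close>.
\<close>

definition graded_matrix :: "('n \<Rightarrow> int) \<Rightarrow> ('m \<Rightarrow> int) \<Rightarrow> poly3 ^ 'n ^ 'm \<Rightarrow> bool" where
  "graded_matrix u v A \<longleftrightarrow> (\<forall>i j. A $ i $ j \<in> forms (u j - v i))"

text \<open>
  With \<open>F_0, F_1, F_2\<close> the direct sums of the modules \<open>R(-u0 i)\<close>, \<open>R(-u1 i)\<close>, \<open>R(-u2 i)\<close>,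
  \<open>0 \<rightarrow> F_2 \<rightarrow> F_1 \<rightarrow> F_0 \<rightarrow> J(e) \<rightarrow> 0\<close>, with maps \<open>P\<close>, \<open>M\<close> and the row \<open>h\<close>, is a minimal graded
  free resolution. The generator of \<open>R(-u)\<close> has degree \<open>u\<close>, and \<open>J(e)_u = J_(e+u)\<close>. Minimality
  means that the images of \<open>M\<close> and \<open>P\<close> lie in \<open>m F_0\<close> and \<open>m F_1\<close>.
\<close>

definition minimal_free_resolution ::
  "poly3 set \<Rightarrow> int \<Rightarrow> ('a \<Rightarrow> int) \<Rightarrow> ('b \<Rightarrow> int) \<Rightarrow> ('c \<Rightarrow> int) \<Rightarrow>
   poly3 ^ 'a \<Rightarrow> poly3 ^ 'b ^ 'a \<Rightarrow> poly3 ^ 'c ^ 'b \<Rightarrow> bool" where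
  "minimal_free_resolution J e u0 u1 u2 h M P \<longleftrightarrow>
     (\<forall>i. h $ i \<in> forms (e + u0 i)) \<and> graded_matrix u1 u0 M \<and> graded_matrix u2 u1 P \<and>
     range (row_map h) = J \<and>
     {v. row_map h v = 0} = range (\<lambda>w. M *v w) \<and>
     {w. M *v w = 0} = range (\<lambda>z. P *v z) \<and>
     inj (\<lambda>z. P *v z) \<and>
     (\<forall>i j. M $ i $ j \<in> irrelevant_ideal) \<and> (\<forall>i j. P $ i $ j \<in> irrelevant_ideal)"

text \<open>
  \<open>M\<close> and \<open>P\<close> are first and second syzygy matrices of a nearly free curve \<open>V(f)\<close> of degree \<open>d\<close>:
  with \<open>r = mdr f\<close>, they are the maps in a minimal free resolution
  \<open>0 \<rightarrow> R(-d+r-1) \<rightarrow> R(-r) \<oplus> R(-d+r)^2 \<rightarrow> R^3 \<rightarrow> J_f(d-1) \<rightarrow> 0\<close>.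
\<close>

definition syzygy_matrices :: "poly3 \<Rightarrow> nat \<Rightarrow> poly3 ^ 3 ^ 3 \<Rightarrow> poly3 ^ 1 ^ 3 \<Rightarrow> bool" where
  "syzygy_matrices f d M P \<longleftrightarrow>
     (let r = int (mdr f) in
        minimal_free_resolution (jacobian_ideal f) (int d - 1)
          (\<lambda>_. 0) (\<lambda>j. if j = 1 then r else int d - r) (\<lambda>_. int d - r + 1)
          (grad f) M P)"

end

theory Submission
  imports Defs "HOL-Computational_Algebra.Field_as_Ring"
begin

text \<open>
  Because \<open>x1\<close> and \<open>x2\<close> are coprime, the linear syzygy \<open>b x1 \<partial>1f + c x2 \<partial>2f = 0\<close> means that
  \<open>\<partial>1f = c x2 h\<close> and \<open>\<partial>2f = - b x1 h\<close> for some \<open>h\<close> (\<open>koszul_X1_X2\<close>), which is nonzero as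
  \<open>mdr f = 1\<close>. By the Euler identity a common prime factor of \<open>\<partial>0f\<close> and \<open>h\<close> would be a multiple factor of
  \<open>f\<close>, so \<open>\<partial>0f\<close> and \<open>h\<close> are coprime (\<open>squarefree_partials_no_common_prime\<close>).

  A syzygy \<open>(u, v, w)\<close> of the partial derivatives now satisfies \<open>u \<partial>0f = h (b x1 w - c x2 v)\<close>. Hence
  \<open>u = h s\<close> with \<open>s \<partial>0f \<in> (x1, x2)\<close>. As \<open>\<partial>0f\<close> is congruent to \<open>\<omega> = a x0 ^ (d - 1)\<close> modulo this prime ideal
  and \<open>a \<noteq> 0\<close>, \<open>s\<close> itself is a combination of \<open>x1\<close> and \<open>x2\<close>. The first entries of the last two
  columns of the matrix are \<open>- c x2 h\<close> and \<open>b x1 h\<close>, so subtracting multiples of these columns achieves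
  \<open>u = 0\<close>, and what is left is a multiple of the given linear syzygy (\<open>syzygy_decomposition\<close>). Thus the
  three columns generate all syzygies. The relations among the columns are read off from the second and
  third row (\<open>second_syzygy\<close>); they are the multiples of a single nonzero vector, so that the last map is
  injective.

  The matrices have entries in the irrelevant ideal because their entries are forms of degree \<open>1\<close> or
  \<open>d - 1\<close>, and \<open>d \<ge> 2\<close> for a singular curve.
\<close>

section \<open>Coefficients of ternary forms\<close>

lemma poly3_eqI: "(\<And>i j k. mcoeff p i j k = mcoeff q i j k) \<Longrightarrow> p = q"
  unfolding mcoeff_def by (intro poly_eqI) auto

lemma mcoeff_add: "mcoeff (p + q) i j k = mcoeff p i j k + mcoeff q i j k"
  by (simp add: mcoeff_def)

lemma mcoeff_diff: "mcoeff (p - q) i j k = mcoeff p i j k - mcoeff q i j k"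
  by (simp add: mcoeff_def)

lemma mcoeff_minus: "mcoeff (- p) i j k = - mcoeff p i j k"
  by (simp add: mcoeff_def)

lemma mcoeff_0: "mcoeff 0 i j k = 0"
  by (simp add: mcoeff_def)

lemma mcoeff_cst: "mcoeff (cst a) i j k = (if i = 0 \<and> j = 0 \<and> k = 0 then a else 0)"
  by (simp add: mcoeff_def cst_def coeff_pCons split: nat.split)

lemma mcoeff_cst_mult: "mcoeff (cst a * p) i j k = a * mcoeff p i j k"
  by (simp add: mcoeff_def cst_def)

lemma mcoeff_X0_mult: "mcoeff (X0 * p) i j k = (if i = 0 then 0 else mcoeff p (i - 1) j k)"
  by (simp add: mcoeff_def X0_def coeff_pCons split: nat.split)

lemma mcoeff_X1_mult: "mcoeff (X1 * p) i j k = (if j = 0 then 0 else mcoeff p i (j - 1) k)"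
  by (simp add: mcoeff_def X1_def coeff_pCons split: nat.split)

lemma mcoeff_X2_mult: "mcoeff (X2 * p) i j k = (if k = 0 then 0 else mcoeff p i j (k - 1))"
  by (simp add: mcoeff_def X2_def coeff_pCons split: nat.split)

lemma mcoeff_X0_power_mult:
  "mcoeff (X0 ^ n * p) i j k = (if i < n then 0 else mcoeff p (i - n) j k)"
  by (induction n arbitrary: i) (auto simp: mcoeff_X0_mult mult.assoc)

lemmas mcoeff_simps = mcoeff_add mcoeff_diff mcoeff_minus mcoeff_0 mcoeff_cst mcoeff_cst_mult
  mcoeff_X0_mult mcoeff_X1_mult mcoeff_X2_mult mcoeff_X0_power_mult

lemma cst_1: "cst 1 = 1"
  by (simp add: cst_def one_pCons)

lemma cst_mult: "cst a * cst b = cst (a * b)"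
  by (rule poly3_eqI) (simp add: mcoeff_simps)

lemma cst_eq_0_iff: "cst a = 0 \<longleftrightarrow> a = 0"
  by (simp add: cst_def)

lemma cst_minus: "cst (- a) = - cst a"
  by (simp add: cst_def)

lemma is_unit_cst: "a \<noteq> 0 \<Longrightarrow> is_unit (cst a)"
  by (rule dvdI[of _ _ "cst (inverse a)"]) (simp add: cst_mult cst_1)

lemma X1_neq_0: "X1 \<noteq> 0"
  by (simp add: X1_def)

lemma X1_dvd_iff: "X1 dvd p \<longleftrightarrow> (\<forall>i k. mcoeff p i 0 k = 0)"
proof -
  have "X1 dvd p \<longleftrightarrow> (\<forall>i. [:0, 1:] dvd coeff p i)"
    by (simp add: X1_def const_poly_dvd_iff)
  also have "\<dots> \<longleftrightarrow> (\<forall>i. coeff (coeff p i) 0 = 0)"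
    by (metis minus_zero poly_0_coeff_0 poly_eq_0_iff_dvd)
  also have "\<dots> \<longleftrightarrow> (\<forall>i k. mcoeff p i 0 k = 0)"
    by (simp add: mcoeff_def poly_eq_iff)
  finally show ?thesis .
qed

text \<open>A polynomial without pure powers of \<open>x0\<close> vanishes for \<open>x1 = x2 = 0\<close>, so it lies in the ideal \<open>(x1, x2)\<close>.\<close>

lemma in_ideal_X1_X2:
  assumes "\<And>i. mcoeff p i 0 0 = 0"
  shows "\<exists>u v. p = X1 * u + X2 * v"
  using assms
proof (induction p)
  case 0
  show ?case by (intro exI[of _ 0]) simp
next
  case (pCons c p)
  have "mcoeff p i 0 0 = 0" for i
    using pCons.prems[of "Suc i"] by (simp add: mcoeff_def)
  then obtain u v where uv: "p = X1 * u + X2 * v"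
    using pCons.IH by blast
  obtain e r where c: "c = pCons e r" by (cases c)
  obtain e0 t where e: "e = pCons e0 t" by (cases e)
  have "e0 = 0"
    using pCons.prems[of 0] by (simp add: mcoeff_def c e)
  then have "pCons c p = X1 * pCons r u + X2 * pCons [:t:] v"
    by (simp add: uv c e X1_def X2_def)
  then show ?case by blast
qed

lemma forms_neg: "p \<in> forms s \<Longrightarrow> s < 0 \<Longrightarrow> p = 0"
  by (rule poly3_eqI) (force simp: forms_def mcoeff_simps)

lemma forms_0: "0 \<in> forms s"
  by (simp add: forms_def mcoeff_simps)

lemma forms_minus: "p \<in> forms s \<Longrightarrow> - p \<in> forms s"
  by (simp add: forms_def mcoeff_simps)

lemma forms_cst_mult: "p \<in> forms s \<Longrightarrow> cst a * p \<in> forms s"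
  by (simp add: forms_def mcoeff_simps)

lemma forms_1: "1 \<in> forms 0"
  by (simp add: forms_def mcoeff_simps flip: cst_1)

lemma forms_X1_mult: "p \<in> forms (s - 1) \<Longrightarrow> X1 * p \<in> forms s"
  by (force simp: forms_def mcoeff_simps)

lemma forms_X2_mult: "p \<in> forms (s - 1) \<Longrightarrow> X2 * p \<in> forms s"
  by (force simp: forms_def mcoeff_simps)

lemma forms_X1: "X1 \<in> forms 1" and forms_X2: "X2 \<in> forms 1"
  using forms_X1_mult[of 1 1] forms_X2_mult[of 1 1] forms_1 by simp_all

lemma forms_D0: "p \<in> forms s \<Longrightarrow> D0 p \<in> forms (s - 1)"
  by (force simp: forms_def mcoeff_D0)

lemma forms_D1: "p \<in> forms s \<Longrightarrow> D1 p \<in> forms (s - 1)"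
  by (force simp: forms_def mcoeff_D1)

lemma forms_D2: "p \<in> forms s \<Longrightarrow> D2 p \<in> forms (s - 1)"
  by (force simp: forms_def mcoeff_D2)

lemma form_in_x0_monomial:
  assumes "p \<in> polys_x0" and "p \<in> forms (int n)"
  shows "p = cst (mcoeff p n 0 0) * X0 ^ n"
proof (rule poly3_eqI)
  fix i j k
  have "mcoeff p i j k = 0" if "\<not> (i = n \<and> j = 0 \<and> k = 0)"
    using assms that by (force simp: polys_x0_def forms_def)
  then have "mcoeff p i j k = mcoeff (cst (mcoeff p n 0 0) * (X0 ^ n * cst 1)) i j k"
    by (auto simp only: mcoeff_cst_mult mcoeff_X0_power_mult mcoeff_cst) auto
  then show "mcoeff p i j k = mcoeff (cst (mcoeff p n 0 0) * X0 ^ n) i j k"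
    by (simp add: cst_1)
qed

lemma module_mult: "module ((*) :: poly3 \<Rightarrow> poly3 \<Rightarrow> poly3)"
  by unfold_locales (simp_all add: algebra_simps)

lemma ideal_gen_triple: "ideal_gen {p, q, r} = {u * p + v * q + w * r | u v w. True}"
proof -
  have "x \<in> ideal_gen {p, q, r} \<longleftrightarrow> (\<exists>u v w. x - u * p - v * q - w * r = 0)" for x
    unfolding ideal_gen_def
    by (simp add: module.span_insert[OF module_mult] module.span_empty[OF module_mult])
  moreover have "x - u * p - v * q - w * r = 0 \<longleftrightarrow> x = u * p + v * q + w * r" for x u v w
    by (auto simp: algebra_simps)
  ultimately show ?thesis
    by auto
qed

lemma in_irrelevant_ideal:
  assumes "mcoeff p 0 0 0 = 0"
  shows "p \<in> irrelevant_ideal"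
proof -
  obtain c q where p: "p = pCons c q" by (cases p)
  obtain e r where c: "c = pCons e r" by (cases c)
  obtain e0 t where e: "e = pCons e0 t" by (cases e)
  have "e0 = 0"
    using assms by (simp add: mcoeff_def p c e)
  then have "p = q * X0 + [:r:] * X1 + [:[:t:]:] * X2"
    by (simp add: p c e X0_def X1_def X2_def)
  then show ?thesis
    unfolding irrelevant_ideal_def ideal_gen_triple by blast
qed

lemma form_in_irrelevant_ideal: "p \<in> forms s \<Longrightarrow> s \<noteq> 0 \<Longrightarrow> p \<in> irrelevant_ideal"
  by (rule in_irrelevant_ideal) (force simp: forms_def)

section \<open>The partial derivatives as derivations\<close>

lemma euler_identity:
  assumes "f \<in> forms (int d)"
  shows "X0 * D0 f + X1 * D1 f + X2 * D2 f = cst (of_nat d) * f"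
proof (rule poly3_eqI)
  fix i j k
  have "mcoeff (X0 * D0 f + X1 * D1 f + X2 * D2 f) i j k = of_nat (i + j + k) * mcoeff f i j k"
    by (cases i; cases j; cases k)
      (simp_all add: mcoeff_simps mcoeff_D0 mcoeff_D1 mcoeff_D2 algebra_simps)
  also have "\<dots> = of_nat d * mcoeff f i j k"
    using assms by (cases "mcoeff f i j k = 0") (auto simp: forms_def simp flip: of_nat_add)
  finally show "mcoeff (X0 * D0 f + X1 * D1 f + X2 * D2 f) i j k = mcoeff (cst (of_nat d) * f) i j k"
    by (simp add: mcoeff_simps)
qed

definition derivation :: "('a::comm_ring_1 \<Rightarrow> 'a) \<Rightarrow> bool" where
  "derivation \<delta> \<longleftrightarrow> (\<forall>x y. \<delta> (x + y) = \<delta> x + \<delta> y) \<and> (\<forall>x y. \<delta> (x * y) = \<delta> x * y + x * \<delta> y)"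

text \<open>
  Over a domain a polynomial divides its derivative only if the derivative is zero, because
  differentiation lowers the degree. The property is stated for arbitrary maps because
  \<^const>\<open>D1\<close> and \<^const>\<open>D2\<close> inherit it from the derivative of the coefficients.
\<close>

definition only_trivial_eigenvectors :: "('a::comm_ring_1 \<Rightarrow> 'a) \<Rightarrow> bool" where
  "only_trivial_eigenvectors \<delta> \<longleftrightarrow> (\<forall>x. x dvd \<delta> x \<longrightarrow> \<delta> x = 0)"

lemma derivation_zero: "derivation \<delta> \<Longrightarrow> \<delta> 0 = 0"
  unfolding derivation_def by (metis add.right_neutral add_left_cancel)

lemma derivation_sum: "derivation \<delta> \<Longrightarrow> \<delta> (sum h A) = (\<Sum>a\<in>A. \<delta> (h a))"
  by (induction A rule: infinite_finite_induct) (auto simp: derivation_zero derivation_def)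

lemma derivation_pderiv: "derivation (pderiv :: 'a::idom poly \<Rightarrow> 'a poly)"
  by (simp add: derivation_def pderiv_add pderiv_mult algebra_simps)

lemma derivation_map_poly:
  assumes "derivation \<delta>"
  shows "derivation (map_poly \<delta>)"
proof -
  note z = derivation_zero[OF assms]
  have "map_poly \<delta> (p + q) = map_poly \<delta> p + map_poly \<delta> q" for p q
    using assms by (intro poly_eqI) (simp add: coeff_map_poly z derivation_def)
  moreover have "map_poly \<delta> (p * q) = map_poly \<delta> p * q + p * map_poly \<delta> q" for p q
  proof (rule poly_eqI)
    fix n
    have "\<delta> (coeff p i * coeff q (n - i)) =
        \<delta> (coeff p i) * coeff q (n - i) + coeff p i * \<delta> (coeff q (n - i))" for i
      using assms by (simp add: derivation_def)
    then show "coeff (map_poly \<delta> (p * q)) n = coeff (map_poly \<delta> p * q + p * map_poly \<delta> q) n"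
      by (simp add: coeff_map_poly z coeff_mult derivation_sum[OF assms] sum.distrib)
  qed
  ultimately show ?thesis
    by (simp add: derivation_def)
qed

lemma only_trivial_eigenvectors_pderiv: "only_trivial_eigenvectors (pderiv :: 'a::idom poly \<Rightarrow> 'a poly)"
  unfolding only_trivial_eigenvectors_def
proof (intro allI impI)
  fix p :: "'a poly"
  assume dvd: "p dvd pderiv p"
  show "pderiv p = 0"
  proof (rule ccontr)
    assume ne: "pderiv p \<noteq> 0"
    then have "degree p \<noteq> 0"
      by (metis degree_eq_zeroE pderiv_singleton)
    moreover have "degree (pderiv p) \<le> degree p - 1"
      by (intro degree_le allI impI) (simp add: coeff_pderiv coeff_eq_0)
    moreover have "degree p \<le> degree (pderiv p)"
      using dvd ne by (rule dvd_imp_degree_le)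
    ultimately show False by linarith
  qed
qed

text \<open>
  Acting on coefficients does not raise the degree, so the cofactor in \<open>p dvd map_poly \<delta> p\<close> is a
  constant, and each coefficient of \<open>p\<close> divides its own image.
\<close>

lemma only_trivial_eigenvectors_map_poly:
  fixes \<delta> :: "'a::idom \<Rightarrow> 'a"
  assumes "only_trivial_eigenvectors \<delta>" and z: "\<delta> 0 = 0"
  shows "only_trivial_eigenvectors (map_poly \<delta>)"
  unfolding only_trivial_eigenvectors_def
proof (intro allI impI)
  fix p :: "'a poly"
  assume "p dvd map_poly \<delta> p"
  then obtain t where t: "map_poly \<delta> p = p * t" by (rule dvdE)
  show "map_poly \<delta> p = 0"
  proof (cases "p = 0 \<or> t = 0")
    case True
    then show ?thesis using t by auto
  next
    case False
    have "degree (map_poly \<delta> p) \<le> degree p"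
      by (intro degree_le) (simp add: coeff_map_poly z coeff_eq_0)
    with False t have "degree t = 0"
      by (simp add: degree_mult_eq)
    then obtain t0 where "t = [:t0:]"
      by (rule degree_eq_zeroE)
    then have "\<delta> (coeff p i) = coeff p i * t0" for i
      using arg_cong[OF t, of "\<lambda>q. coeff q i"] by (simp add: coeff_map_poly z mult.commute)
    then have "\<delta> (coeff p i) = 0" for i
      using assms(1) unfolding only_trivial_eigenvectors_def by (metis dvd_triv_left)
    then show ?thesis
      by (intro poly_eqI) (simp add: coeff_map_poly z)
  qed
qed

lemma derivation_partials: "derivation D0" "derivation D1" "derivation D2"
  unfolding D0_def[abs_def] D1_def[abs_def] D2_def[abs_def]
  by (intro derivation_map_poly derivation_pderiv)+

lemma only_trivial_eigenvectors_partials: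
  "only_trivial_eigenvectors D0" "only_trivial_eigenvectors D1" "only_trivial_eigenvectors D2"
  unfolding D0_def[abs_def] D1_def[abs_def] D2_def[abs_def]
  by (intro only_trivial_eigenvectors_pderiv only_trivial_eigenvectors_map_poly; simp)+

lemma constant_if_partials_zero:
  assumes "D0 q = 0" "D1 q = 0" "D2 q = 0"
  shows "q = cst (mcoeff q 0 0 0)"
proof (rule poly3_eqI)
  fix i j k
  have "mcoeff q (Suc i) j k = 0" "mcoeff q i (Suc j) k = 0" "mcoeff q i j (Suc k) = 0" for i j k
    using mcoeff_D0[of q i j k] mcoeff_D1[of q i j k] mcoeff_D2[of q i j k] assms
    by (simp_all add: mcoeff_0 del: of_nat_Suc)
  then show "mcoeff q i j k = mcoeff (cst (mcoeff q 0 0 0)) i j k"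
    by (cases i; cases j; cases k) (simp_all add: mcoeff_cst)
qed

lemma prime_dvd_derivation:
  assumes "derivation \<delta>" and "only_trivial_eigenvectors \<delta>"
    and q: "prime_elem q" "\<not> q dvd m" and "q dvd \<delta> (q * m)"
  shows "\<delta> q = 0"
proof -
  have "\<delta> (q * m) = \<delta> q * m + q * \<delta> m"
    using assms(1) by (simp add: derivation_def)
  with assms(5) have "q dvd \<delta> q * m"
    by (simp add: dvd_add_left_iff)
  with q have "q dvd \<delta> q"
    by (simp add: prime_elem_dvd_mult_iff)
  with assms(2) show ?thesis
    by (simp add: only_trivial_eigenvectors_def)
qed

text \<open>
  By the Euler identity a common prime factor \<open>q\<close> of the derivatives divides \<open>f\<close>, and only once
  because \<open>f\<close> is squarefree. If \<open>f = q m\<close>, then by the product rule \<open>q\<close> divides each \<open>\<partial>q \<cdot> m\<close>, hence each of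
  its own derivatives; these are therefore zero and \<open>q\<close> is constant.
\<close>

lemma squarefree_partials_no_common_prime:
  assumes f: "f \<in> forms (int d)" "squarefree f" and d: "d \<noteq> 0" and q: "prime_elem q"
    and dvd: "q dvd D0 f" "q dvd D1 f" "q dvd D2 f"
  shows False
proof -
  have "q dvd X0 * D0 f + X1 * D1 f + X2 * D2 f"
    using dvd by simp
  then have "q dvd cst (of_nat d) * f"
    by (simp add: euler_identity[OF f(1)])
  moreover have "is_unit (cst (of_nat d))"
    using d by (intro is_unit_cst) simp
  ultimately have "q dvd f"
    by (simp add: dvd_mult_unit_iff')
  then obtain m where m: "f = q * m" by (rule dvdE)
  have "\<not> q dvd m"
  proof
    assume "q dvd m"
    then have "q ^ 2 dvd f"
      by (simp add: m power2_eq_square)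
    with f(2) q show False
      by (auto dest: squarefreeD prime_elem_not_unit)
  qed
  then have "D0 q = 0" "D1 q = 0" "D2 q = 0"
    using prime_dvd_derivation[OF derivation_partials(1) only_trivial_eigenvectors_partials(1) q]
      prime_dvd_derivation[OF derivation_partials(2) only_trivial_eigenvectors_partials(2) q]
      prime_dvd_derivation[OF derivation_partials(3) only_trivial_eigenvectors_partials(3) q]
      dvd by (simp_all add: m)
  then have "q = cst (mcoeff q 0 0 0)"
    by (rule constant_if_partials_zero)
  with q show False
    by (metis cst_eq_0_iff is_unit_cst prime_elem_def)
qed

section \<open>Exactness\<close>

text \<open>
  The relation says that \<open>x1\<close> divides \<open>x2 q\<close>, hence \<open>q\<close>, by comparison of the coefficients without \<open>x1\<close>.
  So \<open>(p, q)\<close> is a multiple of the Koszul relation between \<open>b x1\<close> and \<open>c x2\<close>.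
\<close>

lemma koszul_X1_X2:
  assumes "b \<noteq> 0" "c \<noteq> 0" and rel: "cst b * X1 * p + cst c * X2 * q = 0"
  obtains h where "p = cst c * X2 * h" and "q = - (cst b * X1 * h)"
proof -
  have "mcoeff (cst b * (X1 * p) + cst c * (X2 * q)) i 0 (Suc k) = 0" for i k
    using rel by (simp add: mult.assoc mcoeff_0)
  then have "mcoeff q i 0 k = 0" for i k
    using \<open>c \<noteq> 0\<close> by (simp add: mcoeff_simps)
  then have "X1 dvd q"
    by (simp add: X1_dvd_iff)
  then obtain m where m: "q = X1 * m" by (rule dvdE)
  define h where "h = cst (- inverse b) * m"
  have bb: "cst b * cst (- inverse b) = - 1"
    using \<open>b \<noteq> 0\<close> by (simp add: cst_mult cst_minus cst_1)
  have q: "q = - (cst b * X1 * h)"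
  proof -
    have "- (cst b * X1 * h) = - (cst b * cst (- inverse b)) * (X1 * m)"
      by (simp add: h_def ac_simps)
    then show ?thesis by (simp only: bb m) simp
  qed
  have "(cst b * X1) * (p - cst c * X2 * h) = 0"
    using rel by (simp add: q algebra_simps)
  then have "p = cst c * X2 * h"
    using \<open>b \<noteq> 0\<close> by (simp add: cst_eq_0_iff X1_neq_0)
  with q show thesis by (rule that[rotated])
qed

text \<open>
  Coprimality of \<open>p0\<close> and \<open>h\<close> forces \<open>u = h s\<close> with \<open>s p0\<close> in the ideal \<open>(x1, x2)\<close>. Modulo this prime
  ideal \<open>p0\<close> is a nonzero multiple of a power of \<open>x0\<close>, so \<open>s\<close> lies in it as well, and writing \<open>s\<close> in terms
  of \<open>x1\<close> and \<open>x2\<close> yields the coefficients \<open>\<beta>\<close> and \<open>\<gamma>\<close>. What remains is the relation between \<open>x1\<close> and \<open>x2\<close>,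
  which gives \<open>\<alpha>\<close>.
\<close>

lemma syzygy_decomposition:
  assumes bc: "b \<noteq> 0" "c \<noteq> 0" and a: "a \<noteq> 0"
    and p0: "p0 = g * X1 + cst a * X0 ^ n"
    and h: "h \<noteq> 0" "coprime p0 h"
    and syz: "u * p0 + v * (cst c * X2 * h) + w * - (cst b * X1 * h) = 0"
  obtains \<alpha> \<beta> \<gamma> where
    "u = - (cst c * X2 * h) * \<beta> + cst b * X1 * h * \<gamma>"
    "v = cst b * X1 * \<alpha> + cst a * X0 ^ n * \<beta>"
    "w = cst c * X2 * \<alpha> - cst (c / b) * g * X2 * \<beta> + p0 * \<gamma>"
proof -
  have "u * p0 = h * (cst b * X1 * w - cst c * X2 * v)"
    using syz by (simp add: algebra_simps)
  then have "h dvd u * p0" by simp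
  then have "h dvd u"
    using h(2) by (metis coprime_commute coprime_dvd_mult_left_iff)
  then obtain s where s: "u = h * s" by (rule dvdE)
  have "h * (s * p0 - cst b * X1 * w + cst c * X2 * v) = 0"
    using syz by (simp add: s algebra_simps)
  with h(1) have rel: "s * p0 - cst b * X1 * w + cst c * X2 * v = 0"
    by simp
  have "mcoeff s i 0 0 = 0" for i
  proof -
    have "cst a * (X0 ^ n * s) = X1 * (cst b * w - g * s) + X2 * - (cst c * v)"
      using rel by (simp add: p0 algebra_simps)
    then have "mcoeff (cst a * (X0 ^ n * s)) (i + n) 0 0 = 0"
      by (simp add: mcoeff_diff mcoeff_X1_mult mcoeff_X2_mult)
    with a show ?thesis
      by (simp add: mcoeff_cst_mult mcoeff_X0_power_mult)
  qed
  then obtain y z where yz: "s = X1 * y + X2 * z"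
    using in_ideal_X1_X2 by blast
  define \<beta> where "\<beta> = cst (- inverse c) * z"
  define \<gamma> where "\<gamma> = cst (inverse b) * y"
  have cz: "cst c * \<beta> = - z"
  proof -
    have "cst c * \<beta> = cst (c * - inverse c) * z"
      by (simp add: \<beta>_def mult.assoc[symmetric] cst_mult)
    then show ?thesis using bc by (simp add: cst_minus cst_1)
  qed
  have bg: "cst b * \<gamma> = y"
  proof -
    have "cst b * \<gamma> = cst (b * inverse b) * y"
      by (simp add: \<gamma>_def mult.assoc[symmetric] cst_mult)
    then show ?thesis using bc by (simp add: cst_1)
  qed
  have cb: "cst (c / b) * cst b = cst c"
    using bc by (simp add: cst_mult)
  have s': "s = cst b * X1 * \<gamma> - cst c * X2 * \<beta>"
  proof -
    have "cst b * X1 * \<gamma> - cst c * X2 * \<beta> = X1 * (cst b * \<gamma>) - X2 * (cst c * \<beta>)"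
      by (simp add: ac_simps)
    then show ?thesis by (simp add: cz bg yz)
  qed
  define v' where "v' = v - cst a * X0 ^ n * \<beta>"
  define w' where "w' = w + cst (c / b) * g * X2 * \<beta> - p0 * \<gamma>"
  \<comment> \<open>After subtracting the multiples of the last two columns, a syzygy with first entry zero remains.\<close>
  have "cst b * X1 * w' + cst (- c) * X2 * v' = 0"
  proof -
    have "cst b * X1 * w' + cst (- c) * X2 * v' =
        cst b * X1 * w - cst c * X2 * v - s * p0
        + (cst (c / b) * cst b) * X1 * g * X2 * \<beta> - cst c * X1 * g * X2 * \<beta>"
      by (simp add: s' v'_def w'_def cst_minus algebra_simps) (simp add: p0 algebra_simps)
    also have "\<dots> = 0"
      unfolding cb using rel by (simp add: algebra_simps)
    finally show ?thesis .
  qed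
  then obtain k where k: "w' = cst (- c) * X2 * k" "v' = - (cst b * X1 * k)"
    using koszul_X1_X2[of b "- c" w' v'] bc by auto
  show thesis
  proof (rule that[of \<beta> \<gamma> "- k"])
    show "u = - (cst c * X2 * h) * \<beta> + cst b * X1 * h * \<gamma>"
      by (simp add: s s' algebra_simps)
    show "v = cst b * X1 * - k + cst a * X0 ^ n * \<beta>"
      using k(2) by (simp add: v'_def algebra_simps)
    show "w = cst c * X2 * - k - cst (c / b) * g * X2 * \<beta> + p0 * \<gamma>"
      using k(1) by (simp add: w'_def cst_minus algebra_simps)
  qed
qed

text \<open>
  The relations among the columns of the first syzygy matrix. The second row says that
  \<open>x1\<close> divides \<open>x0 ^ n * w2\<close>, so it divides \<open>w2\<close>, and \<open>w1\<close>, \<open>w2\<close> are determined up to a common factor \<open>z\<close>. Then the third row becomes \<open>p0 (w3 + c x2 z) = 0\<close>.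
\<close>

lemma second_syzygy:
  assumes bc: "b \<noteq> 0" and a: "a \<noteq> 0"
    and p0: "p0 = g * X1 + cst a * X0 ^ n" "p0 \<noteq> 0"
    and row2: "cst b * X1 * w1 + cst a * X0 ^ n * w2 = 0"
    and row3: "cst c * X2 * w1 - cst (c / b) * g * X2 * w2 + p0 * w3 = 0"
  obtains z where "w1 = cst a * X0 ^ n * z" "w2 = - (cst b * X1) * z" "w3 = - (cst c * X2) * z"
proof -
  have "mcoeff (cst b * (X1 * w1) + cst a * (X0 ^ n * w2)) (i + n) 0 k = 0" for i k
    using row2 by (simp add: mult.assoc mcoeff_0)
  then have "mcoeff w2 i 0 k = 0" for i k
    using a by (simp add: mcoeff_add mcoeff_cst_mult mcoeff_X1_mult mcoeff_X0_power_mult)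
  then have "X1 dvd w2"
    by (simp add: X1_dvd_iff)
  then obtain y where y: "w2 = X1 * y" by (rule dvdE)
  define z where "z = cst (- inverse b) * y"
  have bz: "cst b * z = - y"
  proof -
    have "cst b * z = cst (b * - inverse b) * y"
      by (simp add: z_def mult.assoc[symmetric] cst_mult)
    then show ?thesis using bc by (simp add: cst_minus cst_1)
  qed
  have w2: "w2 = - (cst b * X1) * z"
  proof -
    have "- (cst b * X1) * z = - X1 * (cst b * z)" by (simp add: ac_simps)
    then show ?thesis by (simp add: bz y)
  qed
  have "cst b * X1 * (w1 - cst a * X0 ^ n * z) = 0"
    using row2 by (simp add: w2 algebra_simps)
  with bc have w1: "w1 = cst a * X0 ^ n * z"
    by (simp add: cst_eq_0_iff X1_neq_0)
  have cb: "cst (c / b) * cst b = cst c"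
    using bc by (simp add: cst_mult)
  have "p0 * (w3 + cst c * X2 * z) =
      p0 * w3 + cst c * X2 * (cst a * X0 ^ n * z) + (cst (c / b) * cst b) * g * X2 * X1 * z"
    unfolding cb by (simp add: p0(1) algebra_simps)
  also have "\<dots> = 0"
    using row3 by (simp add: w1 w2 algebra_simps)
  finally have "w3 = - (cst c * X2) * z"
    using p0(2) by (simp add: eq_neg_iff_add_eq_0)
  with w1 w2 show thesis by (rule that)
qed

theorem proposition5p10:
  fixes f g \<omega> :: poly3 and b c :: complex and d :: nat
  assumes "f \<in> forms (int d)"
    and "squarefree f"
    and "singular_curve f"
    and "nearly_free f"
    and "mdr f = 1"
    and "b \<noteq> 0" and "c \<noteq> 0"
    and "vector [0, cst b * X1, cst c * X2] \<in> Syz f 1"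
    and "g \<in> forms (int d - 2)"
    and "\<omega> \<in> polys_x0 \<inter> forms (int d - 1)" and "\<omega> \<noteq> 0"
    and "D0 f = g * X1 + \<omega>"
  shows "syzygy_matrices f d
    (vector [
      vector [0,           - D1 f,                - D2 f],
      vector [cst b * X1,  \<omega>,                      0],
      vector [cst c * X2,  - (cst (c / b) * g * X2), D0 f]])
    (vector [
      vector [\<omega>],
      vector [- (cst b * X1)],
      vector [- (cst c * X2)]])"
proof -
  have "d \<noteq> 0"
    using assms(10,11) forms_neg[of \<omega> "- 1"] by (cases "d = 0") auto
  define n where "n = d - 1"
  have n: "int d - 1 = int n"
    using \<open>d \<noteq> 0\<close> by (simp add: n_def)
  obtain a where \<omega>: "\<omega> = cst a * X0 ^ n"
    using form_in_x0_monomial[of \<omega> n] assms(10) n by auto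
  have a: "a \<noteq> 0"
    using assms(11) by (auto simp: \<omega> cst_eq_0_iff)
  have D0f: "D0 f = g * X1 + cst a * X0 ^ n"
    using assms(12) \<omega> by simp
  \<comment> \<open>Lines are excluded because they are smooth; for \<open>d = 1\<close> the entry \<open>\<omega>\<close> would be a unit and minimality would fail.\<close>
  have d: "int d - 1 \<noteq> 0"
  proof
    assume d1: "int d - 1 = 0"
    then have "g = 0"
      using assms(9) by (intro forms_neg) auto
    with d1 n have "D0 f = cst a"
      by (simp add: D0f)
    moreover obtain a0 a1 a2 where "eval3 (D0 f) a0 a1 a2 = 0"
      using assms(3) by (auto simp: singular_curve_def)
    ultimately show False
      using a by (simp add: eval3_def cst_def)
  qed
  have D0f_ne: "D0 f \<noteq> 0"
  proof
    assume "D0 f = 0"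
    then have "mcoeff (X1 * g + cst a * (X0 ^ n * cst 1)) n 0 0 = 0"
      by (simp add: D0f mcoeff_0 cst_1 mult.commute)
    with a show False
      by (simp add: mcoeff_simps)
  qed
  have rel: "cst b * X1 * D1 f + cst c * X2 * D2 f = 0"
    using assms(8) by (simp add: Syz_def row_map_def grad_def sum_3 vector_3)
  obtain h where D1f: "D1 f = cst c * X2 * h" and D2f: "D2 f = - (cst b * X1 * h)"
    using koszul_X1_X2[OF assms(6,7) rel] by blast
  \<comment> \<open>For \<open>h = 0\<close> the form \<open>f\<close> is a multiple of \<open>x0 ^ d\<close>, and \<open>(0, 1, 0)\<close> is a syzygy of degree zero.\<close>
  have "h \<noteq> 0"
  proof
    assume "h = 0"
    then have "vector [0, 1, 0] \<in> Syz f (int 0)"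
      using D1f D2f
      by (simp add: Syz_def row_map_def grad_def sum_3 vector_3 forall_3 forms_0 forms_1)
    moreover have "vector [0, 1, 0] \<noteq> (0 :: poly3 ^ 3)"
      by (simp add: vec_eq_iff forall_3 vector_3)
    ultimately have "mdr f \<le> 0"
      unfolding mdr_def by (intro Least_le) blast
    with assms(5) show False by simp
  qed
  have cop: "coprime (D0 f) h"
  proof (rule ccontr)
    assume "\<not> coprime (D0 f) h"
    then have "\<not> is_unit (gcd (D0 f) h)"
      using is_unit_gcd by blast
    then obtain q where q: "prime q" "q dvd gcd (D0 f) h"
      using prime_divisor_exists[of "gcd (D0 f) h"] D0f_ne by auto
    then have "prime_elem q" "q dvd D0 f" "q dvd h"
      by auto
    then show False
      using squarefree_partials_no_common_prime[OF assms(1,2) \<open>d \<noteq> 0\<close>, of q] D1f D2f by simp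
  qed

  let ?M = "vector [
      vector [0,           - D1 f,                - D2 f],
      vector [cst b * X1,  \<omega>,                      0],
      vector [cst c * X2,  - (cst (c / b) * g * X2), D0 f]] :: poly3 ^ 3 ^ 3"
  let ?P = "vector [
      vector [\<omega>],
      vector [- (cst b * X1)],
      vector [- (cst c * X2)]] :: poly3 ^ 1 ^ 3"
  have M: "?M *v w = vector [- D1 f * w $ 2 - D2 f * w $ 3,
      cst b * X1 * w $ 1 + \<omega> * w $ 2,
      cst c * X2 * w $ 1 - cst (c / b) * g * X2 * w $ 2 + D0 f * w $ 3]" for w
    by (simp add: vec_eq_iff forall_3 matrix_vector_mult_def sum_3 vector_3)
  have P: "?P *v z = vector [\<omega> * z $ 1, - (cst b * X1) * z $ 1, - (cst c * X2) * z $ 1]" for z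
    by (simp add: vec_eq_iff forall_3 matrix_vector_mult_def vector_3 vector_1)
  have row: "row_map (grad f) v = v $ 1 * D0 f + v $ 2 * D1 f + v $ 3 * D2 f" for v
    by (simp add: row_map_def grad_def sum_3 vector_3)
  have cb: "cst (c / b) * cst b = cst c"
    using assms(6) by (simp add: cst_mult)

  have gr: "D0 f \<in> forms (int d - 1)" "D1 f \<in> forms (int d - 1)" "D2 f \<in> forms (int d - 1)"
    "\<omega> \<in> forms (int d - 1)" "cst b * X1 \<in> forms 1" "cst c * X2 \<in> forms 1"
    using assms(1,10) forms_D0 forms_D1 forms_D2 forms_cst_mult forms_X1 forms_X2 by auto
  have gr': "cst (c / b) * g * X2 \<in> forms (int d - 1)"
  proof -
    have "g \<in> forms (int d - 1 - 1)" using assms(9) by simp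
    then have "cst (c / b) * (X2 * g) \<in> forms (int d - 1)"
      by (intro forms_cst_mult forms_X2_mult)
    then show ?thesis by (simp add: ac_simps)
  qed
  have entries: "graded_matrix (\<lambda>j. if j = 1 then 1 else int d - 1) (\<lambda>_. 0) ?M"
    "graded_matrix (\<lambda>_. int d - 1 + 1) (\<lambda>j. if j = 1 then 1 else int d - 1) ?P"
    using gr gr' forms_minus forms_0
    by (simp_all add: graded_matrix_def forall_3 forall_1 vector_3 vector_1)
  have minimal: "?M $ i $ j \<in> irrelevant_ideal" "?P $ j $ k \<in> irrelevant_ideal" for i j k
  proof -
    have "?M $ i $ j \<in> forms ((if j = 1 then 1 else int d - 1) - 0)"
      "?P $ j $ k \<in> forms (int d - 1 + 1 - (if j = 1 then 1 else int d - 1))"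
      using entries unfolding graded_matrix_def by blast+
    then show "?M $ i $ j \<in> irrelevant_ideal" "?P $ j $ k \<in> irrelevant_ideal"
      using d by (auto elim!: form_in_irrelevant_ideal split: if_splits)
  qed

  have image: "range (row_map (grad f)) = jacobian_ideal f"
  proof (intro equalityI subsetI)
    fix x assume "x \<in> range (row_map (grad f))"
    then show "x \<in> jacobian_ideal f"
      by (auto simp: row jacobian_ideal_def ideal_gen_triple)
  next
    fix x assume "x \<in> jacobian_ideal f"
    then obtain u v w where "x = u * D0 f + v * D1 f + w * D2 f"
      by (auto simp: jacobian_ideal_def ideal_gen_triple)
    then have "x = row_map (grad f) (vector [u, v, w])"
      by (simp add: row vector_3)
    then show "x \<in> range (row_map (grad f))" by blast
  qed

  have exact1: "{v. row_map (grad f) v = 0} = range (\<lambda>w. ?M *v w)"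
  proof (intro equalityI subsetI)
    fix v assume "v \<in> {v. row_map (grad f) v = 0}"
    then have "v $ 1 * D0 f + v $ 2 * (cst c * X2 * h) + v $ 3 * - (cst b * X1 * h) = 0"
      by (simp add: row D1f D2f)
    then obtain \<alpha> \<beta> \<gamma> where
      "v $ 1 = - (cst c * X2 * h) * \<beta> + cst b * X1 * h * \<gamma>"
      "v $ 2 = cst b * X1 * \<alpha> + cst a * X0 ^ n * \<beta>"
      "v $ 3 = cst c * X2 * \<alpha> - cst (c / b) * g * X2 * \<beta> + D0 f * \<gamma>"
      using syzygy_decomposition[OF assms(6,7) a D0f \<open>h \<noteq> 0\<close> cop] by blast
    then have "v = ?M *v vector [\<alpha>, \<beta>, \<gamma>]"
      unfolding M by (simp add: vec_eq_iff forall_3 vector_3 \<omega> D1f D2f)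
    then show "v \<in> range (\<lambda>w. ?M *v w)" by blast
  next
    fix v assume "v \<in> range (\<lambda>w. ?M *v w)"
    then obtain w where v: "v = ?M *v w" by blast
    have "row_map (grad f) v =
        (\<omega> + g * X1 - D0 f) * D1 f * w $ 2 + (cst b * X1 * D1 f + cst c * X2 * D2 f) * w $ 1
        - g * (X1 * D1 f + cst (c / b) * X2 * D2 f) * w $ 2"
      unfolding v M row by (simp add: vector_3 algebra_simps)
    also have "X1 * D1 f + cst (c / b) * X2 * D2 f = 0"
    proof -
      have "X1 * D1 f + cst (c / b) * X2 * D2 f = X1 * X2 * h * (cst c - cst (c / b) * cst b)"
        by (simp add: D1f D2f algebra_simps)
      then show ?thesis by (simp add: cb)
    qed
    finally show "v \<in> {v. row_map (grad f) v = 0}"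
      by (simp add: rel assms(12))
  qed

  have exact2: "{w. ?M *v w = 0} = range (\<lambda>z. ?P *v z)"
  proof (intro equalityI subsetI)
    fix w assume "w \<in> {w. ?M *v w = 0}"
    then have "cst b * X1 * w $ 1 + cst a * X0 ^ n * w $ 2 = 0"
      "cst c * X2 * w $ 1 - cst (c / b) * g * X2 * w $ 2 + D0 f * w $ 3 = 0"
      unfolding mem_Collect_eq M by (simp_all add: vec_eq_iff forall_3 vector_3 \<omega>)
    then obtain z where
      "w $ 1 = cst a * X0 ^ n * z" "w $ 2 = - (cst b * X1) * z" "w $ 3 = - (cst c * X2) * z"
      using second_syzygy[OF assms(6) a D0f D0f_ne] by blast
    then have "w = ?P *v vector [z]"
      unfolding P by (simp add: vec_eq_iff forall_3 vector_3 vector_1 \<omega>)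
    then show "w \<in> range (\<lambda>z. ?P *v z)" by blast
  next
    fix w assume "w \<in> range (\<lambda>z. ?P *v z)"
    then obtain z where w: "w = ?P *v z" by blast
    have "- D1 f * w $ 2 - D2 f * w $ 3 = (cst b * X1 * D1 f + cst c * X2 * D2 f) * z $ 1"
      unfolding w P by (simp add: vector_3 algebra_simps)
    moreover have "cst b * X1 * w $ 1 + \<omega> * w $ 2 = 0"
      unfolding w P by (simp add: vector_3 algebra_simps)
    moreover have "cst c * X2 * w $ 1 - cst (c / b) * g * X2 * w $ 2 + D0 f * w $ 3 =
        ((cst (c / b) * cst b) - cst c) * g * X1 * X2 * z $ 1"
      unfolding w P by (simp add: vector_3 assms(12) algebra_simps)
    ultimately show "w \<in> {w. ?M *v w = 0}"
      unfolding mem_Collect_eq M by (simp add: vec_eq_iff forall_3 vector_3 rel cb)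
  qed

  have "inj (\<lambda>z. ?P *v z)"
    using assms(11) by (intro injI) (simp add: P vec_eq_iff forall_3 forall_1 vector_3)
  moreover have "\<forall>i. grad f $ i \<in> forms (int d - 1 + 0)"
    using gr by (simp add: grad_def forall_3 vector_3)
  ultimately show ?thesis
    unfolding syzygy_matrices_def minimal_free_resolution_def Let_def assms(5) of_nat_1
    using entries minimal image exact1 exact2 by blast
qed

end
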